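(* Let $V$ be a rank one non-discrete valuation domain with quotient field $K$. Suppose that $\mathcal{V}$ is metrizable with a metric $d'$ (i.e., $d'$ is a metric on $\mathcal{V}$ inducing its topology). Then, for any $\delta\in\mathbb{R}\cup\{\infty\}$, the restriction of $d'$ to $\mathcal{V}(\bullet,\delta)$ is not equal to $d_\delta$.
   Context: $\mathrm{Zar}(K(X)|V)$ is the set of valuation domains of $K(X)$ (with quotient field $K(X)$) containing $V$; its Zariski topology is generated by the subbasic open sets $B(\phi)=\{W\mid\phi\in W\}$, $\phi\in K(X)$. $v$ is the valuation associated to $V$, with value group $\Gamma_v\subseteq\mathbb{R}$, and $d(x,y)=e^{-v(x-y)}$ for $x,y\in K$ (with $e^{-\infty}=0$). A sequence $E=\{s_n\}_{n\in\mathbb{N}}$ in $K$ is pseudo-convergent if $v(s_{n+1}-s_n)<v(s_{n+2}-s_{n+1})$ for all $n$. Its breadth is $\delta_E=\lim_{n\to\infty}v(s_{n+1}-s_n)\in\mathbb{R}\cup\{\infty\}$. $V_E=\{\phi\in K(X)\mid \phi(s_n)\in V\text{ for all but finitely many }n\in\mathbb{N}\}$ is a valuation domain of $K(X)$ with $V_E\cap K=V$. $\mathcal{V}$ is the set of all rings $V_E$, $E$ a pseudo-convergent sequence in $K$, with the topology induced by the Zariski topology of $\mathrm{Zar}(K(X)|V)$. $\mathcal{V}(\bullet,\delta)$ is the subset of the rings $V_E$ with $E$ of breadth $\delta$. The metric $d_\delta$ on $\mathcal{V}(\bullet,\delta)$ is the (well-defined) ultrametric distance given by $d_\delta(V_E,V_F)=\lim_{n\to\infty}\max\{d(s_n,t_n)-e^{-\delta},0\}$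 for $E=\{s_n\}_{n\in\mathbb{N}}$, $F=\{t_n\}_{n\in\mathbb{N}}$ pseudo-convergent of breadth $\delta$. *)

theory Defs
  imports "HOL-Analysis.Analysis" "HOL-Computational_Algebra.Polynomial"
    "HOL-Computational_Algebra.Fraction_Field"
begin

section \<open>Valuation domains of a field\<close>

text \<open>Throughout, the field \<open>K\<close> is the type \<open>'k\<close> and \<open>K(X)\<close> is \<open>'k poly fract\<close>. A valuation domain
  whose quotient field is the ambient field is represented by its underlying set.\<close>

definition valuation_domain :: "'a::field set \<Rightarrow> bool" where
  "valuation_domain V \<longleftrightarrow>
     0 \<in> V \<and> 1 \<in> V \<and> (\<forall>x\<in>V. \<forall>y\<in>V. x - y \<in> V \<and> x * y \<in> V) \<and>
     (\<forall>x. x \<noteq> 0 \<longrightarrow> x \<in> V \<or> inverse x \<in> V)"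

definition prime_ideal_of :: "'a::field set \<Rightarrow> 'a set \<Rightarrow> bool" where
  "prime_ideal_of V P \<longleftrightarrow>
     P \<subseteq> V \<and> P \<noteq> V \<and> 0 \<in> P \<and> (\<forall>x\<in>P. \<forall>y\<in>P. x + y \<in> P) \<and>
     (\<forall>a\<in>V. \<forall>x\<in>P. a * x \<in> P) \<and>
     (\<forall>a\<in>V. \<forall>b\<in>V. a * b \<in> P \<longrightarrow> a \<in> P \<or> b \<in> P)"

text \<open>The prime ideals of a valuation domain form a chain, so that rank (Krull dimension) one means
  that there is exactly one nonzero prime ideal.\<close>

definition rank_one :: "'a::field set \<Rightarrow> bool" where
  "rank_one V \<longleftrightarrow> (\<exists>!P. prime_ideal_of V P \<and> P \<noteq> {0})"

text \<open>\<open>v\<close> is a real-valued valuation associated to \<open>V\<close>, with \<open>v 0 = \<infinity>\<close>. For \<open>V\<close> of rank one such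
  a \<open>v\<close> exists and is unique up to a positive factor.\<close>

definition is_valuation_of :: "'a::field set \<Rightarrow> ('a \<Rightarrow> ereal) \<Rightarrow> bool" where
  "is_valuation_of V v \<longleftrightarrow>
     v 0 = \<infinity> \<and> (\<forall>x. x \<noteq> 0 \<longrightarrow> \<bar>v x\<bar> \<noteq> \<infinity>) \<and>
     (\<forall>x y. v (x * y) = v x + v y) \<and> (\<forall>x y. min (v x) (v y) \<le> v (x + y)) \<and>
     V = {x. 0 \<le> v x}"

definition value_group :: "('a::field \<Rightarrow> ereal) \<Rightarrow> real set" where
  "value_group v = {r. \<exists>x. x \<noteq> 0 \<and> v x = ereal r}"

text \<open>A subgroup of \<open>\<real>\<close> is discrete iff it is cyclic.\<close>

definition discrete_valuation :: "('a::field \<Rightarrow> ereal) \<Rightarrow> bool" where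
  "discrete_valuation v \<longleftrightarrow> (\<exists>g. value_group v = range (\<lambda>n::int. of_int n * g))"

section \<open>The Zariski topology\<close>

definition Zar :: "'k::field set \<Rightarrow> 'k poly fract set set" where
  "Zar V = {W. valuation_domain W \<and> (\<forall>c\<in>V. Fract [:c:] 1 \<in> W)}"

definition zariski_topology :: "'k::field set \<Rightarrow> 'k poly fract set topology" where
  "zariski_topology V = topology_generated_by (range (\<lambda>\<phi>. {W \<in> Zar V. \<phi> \<in> W}))"

section \<open>Pseudo-convergent sequences and the rings they define\<close>

text \<open>\<open>e\<^sup>-\<^sup>a\<close>, for \<open>a \<in> \<real> \<union> {\<infinity>}\<close>.\<close>

definition exp_neg :: "ereal \<Rightarrow> real" where
  "exp_neg a = (if a = \<infinity> then 0 else exp (- real_of_ereal a))"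

definition vdist :: "('k::field \<Rightarrow> ereal) \<Rightarrow> 'k \<Rightarrow> 'k \<Rightarrow> real" where
  "vdist v x y = exp_neg (v (x - y))"

definition pseudo_convergent :: "('k::field \<Rightarrow> ereal) \<Rightarrow> (nat \<Rightarrow> 'k) \<Rightarrow> bool" where
  "pseudo_convergent v s \<longleftrightarrow>
     (\<forall>n. v (s (Suc n) - s n) < v (s (Suc (Suc n)) - s (Suc n)))"

definition breadth :: "('k::field \<Rightarrow> ereal) \<Rightarrow> (nat \<Rightarrow> 'k) \<Rightarrow> ereal" where
  "breadth v s = lim (\<lambda>n. v (s (Suc n) - s n))"

text \<open>The rational function \<open>\<phi>\<close> is defined at \<open>a\<close> and takes the value \<open>y\<close> there.\<close>

definition has_value_at :: "'k::field poly fract \<Rightarrow> 'k \<Rightarrow> 'k \<Rightarrow> bool" where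
  "has_value_at \<phi> a y \<longleftrightarrow>
     (\<exists>p q. \<phi> = Fract p q \<and> poly q a \<noteq> 0 \<and> y = poly p a / poly q a)"

definition pc_ring :: "'k::field set \<Rightarrow> (nat \<Rightarrow> 'k) \<Rightarrow> 'k poly fract set" where
  "pc_ring V s = {\<phi>. \<forall>\<^sub>F n in sequentially. \<exists>y\<in>V. has_value_at \<phi> (s n) y}"

definition pc_rings :: "'k::field set \<Rightarrow> ('k \<Rightarrow> ereal) \<Rightarrow> 'k poly fract set set" where
  "pc_rings V v = {pc_ring V s |s. pseudo_convergent v s}"

definition pc_rings_breadth ::
    "'k::field set \<Rightarrow> ('k \<Rightarrow> ereal) \<Rightarrow> ereal \<Rightarrow> 'k poly fract set set" where
  "pc_rings_breadth V v \<delta> = {pc_ring V s |s. pseudo_convergent v s \<and> breadth v s = \<delta>}"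

text \<open>The limit does not depend on the sequences chosen to represent \<open>A\<close> and \<open>B\<close>.\<close>

definition breadth_dist ::
    "'k::field set \<Rightarrow> ('k \<Rightarrow> ereal) \<Rightarrow> ereal \<Rightarrow> 'k poly fract set \<Rightarrow> 'k poly fract set \<Rightarrow> real" where
  "breadth_dist V v \<delta> A B =
     (THE r. \<exists>s t. pseudo_convergent v s \<and> breadth v s = \<delta> \<and> A = pc_ring V s \<and>
                   pseudo_convergent v t \<and> breadth v t = \<delta> \<and> B = pc_ring V t \<and>
                   (\<lambda>n. max (vdist v (s n) (t n) - exp_neg \<delta>) 0) \<longlonglongrightarrow> r)"

end

theory Submission
  imports Defs
begin

text \<open>Pick a real number \<open>a < \<delta>\<close>, elements \<open>s\<^sub>k\<close> of \<open>K\<close> whose values increase strictly and stay below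
  \<open>a\<close>, and a pseudo-convergent sequence \<open>T = (t\<^sub>n)\<close> of breadth \<open>\<delta>\<close> whose values exceed \<open>a\<close>. Since
  \<open>v (s\<^sub>k + t\<^sub>n) = v (s\<^sub>k)\<close>, and since for large \<open>k\<close> the value of \<open>\<phi> x\<close> is the same for all \<open>x\<close> with
  \<open>v x = v (s\<^sub>k)\<close>, the rings of \<open>s\<^sub>k + T\<close> converge to the ring of \<open>(s\<^sub>k)\<close> in the Zariski topology, so
  that they form a Cauchy sequence for any metric inducing it. But the \<open>d\<^sub>\<delta>\<close>-distance of the rings of
  \<open>s\<^sub>k + T\<close> and \<open>s\<^sub>k\<^sub>+\<^sub>1 + T\<close> is at least \<open>e\<^sup>-\<^sup>a - e\<^sup>-\<^sup>\<delta> > 0\<close>.\<close>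

section \<open>Subgroups of the reals\<close>

text \<open>A positive lower bound on the positive elements would produce a least one, and division
  with remainder would make it a generator. So there are arbitrarily small positive elements, whose
  multiples enter every interval.\<close>

lemma real_subgroup_cyclic_or_dense:
  fixes G :: "real set"
  assumes zero: "0 \<in> G" and diff: "\<And>x y. x \<in> G \<Longrightarrow> y \<in> G \<Longrightarrow> x - y \<in> G"
    and noncyc: "\<And>g. G \<noteq> range (\<lambda>n::int. of_int n * g)" and "a < b"
  shows "\<exists>x\<in>G. a < x \<and> x < b"
proof -
  have neg: "- x \<in> G" if "x \<in> G" for x using diff[OF zero that] by simp
  have add: "x + y \<in> G" if "x \<in> G" "y \<in> G" for x y
    using diff[OF that(1) neg[OF that(2)]] by simp
  have natmult: "of_nat n * x \<in> G" if "x \<in> G" for x and n :: nat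
    by (induction n) (auto simp: zero distrib_right intro: add that)
  have mult: "of_int n * x \<in> G" if "x \<in> G" for x and n :: int
    using natmult[OF that, of "nat n"] neg[OF natmult[OF that, of "nat (- n)"]]
    by (cases "n \<ge> 0") auto
  have small: "\<exists>g\<in>G. 0 < g \<and> g < e" if "e > 0" for e
  proof (rule ccontr)
    assume none: "\<not> ?thesis"
    have "G \<noteq> {0}" using noncyc[of 0] by auto
    then obtain y where y: "y \<in> G" "y \<noteq> 0" using zero by blast
    define P where "P = {x\<in>G. x > 0}"
    have "y \<in> P \<or> - y \<in> P" using y neg[OF y(1)] by (auto simp: P_def)
    then have "P \<noteq> {}" by blast
    have bdd: "bdd_below P" unfolding P_def by (intro bdd_belowI[of _ 0]) auto
    \<comment> \<open>No two elements of \<open>G\<close> differ by a positive amount below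
      \<open>e\<close>, so an element of \<open>P\<close> within \<open>e\<close> of the infimum
      must be the least one.\<close>
    obtain g where g: "g \<in> P" "g < Inf P + e"
      using cInf_lessD[OF \<open>P \<noteq> {}\<close>, of "Inf P + e"] \<open>e > 0\<close> by auto
    have least: "g \<le> x" if "x \<in> P" for x
    proof (rule ccontr)
      assume "\<not> g \<le> x"
      moreover have "Inf P \<le> x" using bdd that by (rule cInf_lower[rotated])
      ultimately have "g - x \<in> G" "0 < g - x" "g - x < e"
        using g that diff by (auto simp: P_def)
      with none show False by blast
    qed
    have "x \<in> range (\<lambda>n::int. of_int n * g)" if "x \<in> G" for x
    proof -
      have "g > 0" using g by (simp add: P_def)
      define r where "r = x - of_int \<lfloor>x / g\<rfloor> * g"
      have "r \<in> G" unfolding r_def using that g mult diff by (auto simp: P_def)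
      moreover have "0 \<le> r" "r < g"
        using floor_divide_lower[OF \<open>g > 0\<close>, of x] floor_divide_upper[OF \<open>g > 0\<close>, of x]
        by (auto simp: r_def algebra_simps)
      ultimately have "r = 0" using least[of r] by (force simp: P_def)
      then show ?thesis by (auto simp: r_def)
    qed
    moreover have "range (\<lambda>n::int. of_int n * g) \<subseteq> G" using mult g by (auto simp: P_def)
    ultimately show False using noncyc[of g] by blast
  qed
  obtain g where g: "g \<in> G" "0 < g" "g < b - a" using small[of "b - a"] \<open>a < b\<close> by auto
  \<comment> \<open>The least multiple of \<open>g\<close> strictly above \<open>a\<close>; it
    overshoots by at most \<open>g < b - a\<close>.\<close>
  let ?x = "of_int (\<lfloor>a / g\<rfloor> + 1) * g"
  have "a < ?x" "?x \<le> a + g"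
    using floor_divide_lower[OF g(2), of a] floor_divide_upper[OF g(2), of a]
    by (auto simp: algebra_simps)
  moreover have "?x \<in> G" using g(1) by (rule mult)
  ultimately show ?thesis using g(3) by (intro bexI[of _ ?x]) auto
qed

section \<open>Values of rational functions, exponentials, and limits in generated
  topologies\<close>

text \<open>Since \<open>has_value_at\<close> ranges over all representations of the fraction,
  cross-multiplication is needed to see that one with nonvanishing denominator decides the
  value.\<close>

lemma has_value_at_Fract:
  assumes "poly g a \<noteq> 0"
  shows "has_value_at (Fract f g) a y \<longleftrightarrow> y = poly f a / poly g a"
proof
  assume "has_value_at (Fract f g) a y"
  then obtain p q where pq: "Fract f g = Fract p q" "poly q a \<noteq> 0" "y = poly p a / poly q a"
    by (auto simp: has_value_at_def)
  have "g \<noteq> 0" "q \<noteq> 0" using assms pq(2) by auto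
  with pq(1) have "f * q = p * g" by (simp add: eq_fract)
  then have "poly f a * poly q a = poly p a * poly g a" by (metis poly_mult)
  with assms pq(2,3) show "y = poly f a / poly g a" by (simp add: frac_eq_eq)
qed (use assms in \<open>auto simp: has_value_at_def\<close>)

lemma exp_neg_antimono: "a \<noteq> -\<infinity> \<Longrightarrow> a \<le> b \<Longrightarrow> exp_neg b \<le> exp_neg a"
  by (cases a; cases b) (auto simp: exp_neg_def)

lemma exp_neg_strict_antimono: "a \<noteq> -\<infinity> \<Longrightarrow> a < b \<Longrightarrow> exp_neg b < exp_neg a"
  by (cases a; cases b) (auto simp: exp_neg_def)

lemma tendsto_exp_neg:
  fixes f :: "nat \<Rightarrow> real"
  assumes "(\<lambda>n. ereal (f n)) \<longlonglongrightarrow> \<delta>" and "\<delta> \<noteq> -\<infinity>"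
  shows "(\<lambda>n. exp_neg (ereal (f n))) \<longlonglongrightarrow> exp_neg \<delta>"
proof (cases \<delta>)
  case (real r)
  with assms(1) have "f \<longlonglongrightarrow> r" by simp
  with real show ?thesis by (auto simp: exp_neg_def intro!: tendsto_intros)
next
  case PInf
  then have "filterlim f at_top sequentially" using assms(1) by (simp add: tendsto_PInfty_eq_at_top)
  then have "(\<lambda>n. exp (- f n)) \<longlonglongrightarrow> 0"
    by (intro filterlim_compose[OF exp_at_bot]) (simp add: filterlim_uminus_at_top)
  with PInf show ?thesis by (simp add: exp_neg_def)
qed (use assms in auto)

text \<open>Eventual membership passes to finite intersections and to unions, so subbasic
  neighbourhoods suffice.\<close>

lemma limitin_topology_generated_by:
  assumes "l \<in> \<Union> S" and "\<And>U. U \<in> S \<Longrightarrow> l \<in> U \<Longrightarrow> eventually (\<lambda>n. f n \<in> U) F"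
  shows "limitin (topology_generated_by S) f l F"
proof -
  have "l \<in> U \<longrightarrow> eventually (\<lambda>n. f n \<in> U) F" if "generate_topology_on S U" for U
    using that
  proof induction
    case (UN K)
    show ?case
    proof
      assume "l \<in> \<Union> K"
      then obtain k where "k \<in> K" "l \<in> k" by blast
      with UN.IH have "eventually (\<lambda>n. f n \<in> k) F" by blast
      then show "eventually (\<lambda>n. f n \<in> \<Union> K) F"
        using \<open>k \<in> K\<close> by (auto elim: eventually_mono)
    qed
  qed (use assms(2) in \<open>auto simp: eventually_conj_iff\<close>)
  with assms(1) show ?thesis
    by (auto simp: limitin_def topology_generated_by_topspace openin_topology_generated_by_iff)
qed

section \<open>Arithmetic of a real-valued valuation\<close>

locale real_valuation =
  fixes V :: "'k::field set" and v :: "'k \<Rightarrow> ereal"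
  assumes val: "is_valuation_of V v"
begin

lemma v_zero [simp]: "v 0 = \<infinity>"
  and v_finite: "x \<noteq> 0 \<Longrightarrow> \<bar>v x\<bar> \<noteq> \<infinity>"
  and v_mult: "v (x * y) = v x + v y"
  and v_add: "min (v x) (v y) \<le> v (x + y)"
  and V_iff: "x \<in> V \<longleftrightarrow> 0 \<le> v x"
  using val unfolding is_valuation_of_def by auto

lemma v_real: assumes "x \<noteq> 0" obtains r where "v x = ereal r"
  using v_finite[OF assms] by (cases "v x") auto

lemma v_eq_PInf [simp]: "v x = \<infinity> \<longleftrightarrow> x = 0"
  using v_finite by fastforce

lemma v_MInf [simp]: "v x \<noteq> -\<infinity>"
  using v_finite[of x] by (cases "x = 0") auto

lemma v_one [simp]: "v 1 = 0"
  using v_mult[of 1 1] v_finite[of 1] by (cases "v 1") auto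

lemma v_minus [simp]: "v (- x) = v x"
proof -
  have "v (- 1) + v (- 1) = 0" using v_mult[of "- 1" "- 1"] by simp
  then have "v (- 1) = 0" by (cases "v (- 1)") auto
  then show ?thesis using v_mult[of "- 1" x] by simp
qed

lemma v_minus_commute: "v (x - y) = v (y - x)"
  using v_minus[of "x - y"] by simp

lemma v_diff: "min (v x) (v y) \<le> v (x - y)"
  using v_add[of x "- y"] by simp

text \<open>A larger value of \<open>x + y\<close> would, by \<open>x = (x + y) - y\<close>, force a
  larger value of \<open>x\<close>.\<close>

lemma v_add_eq: assumes "v x < v y" shows "v (x + y) = v x"
  using v_add[of x y] v_diff[of "x + y" y] assms by (auto simp: min_def split: if_splits)

lemma v_diff_eq: assumes "v x < v y" shows "v (x - y) = v x"
  using v_add_eq[of x "- y"] assms by simp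

lemma v_divide: assumes "y \<noteq> 0" shows "v (x / y) = v x - v y"
proof -
  obtain r where "v y = ereal r" using v_real[OF assms] .
  moreover have "v x = v (x / y) + v y" using v_mult[of "x / y" y] assms by simp
  ultimately show ?thesis by (cases "v (x / y)") auto
qed

lemma value_dense:
  assumes "\<not> discrete_valuation v" and "a < b"
  shows "\<exists>x. ereal a < v x \<and> v x < ereal b"
proof -
  have "\<exists>r\<in>value_group v. a < r \<and> r < b"
  proof (rule real_subgroup_cyclic_or_dense)
    show "0 \<in> value_group v" unfolding value_group_def by (auto intro!: exI[of _ 1] simp: zero_ereal_def[symmetric])
    show "r - s \<in> value_group v" if "r \<in> value_group v" "s \<in> value_group v" for r s
    proof -
      from that obtain x y where "x \<noteq> 0" "v x = ereal r" "y \<noteq> 0" "v y = ereal s"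
        by (auto simp: value_group_def)
      then show ?thesis by (auto simp: value_group_def v_divide intro!: exI[of _ "x / y"])
    qed
  qed (use assms in \<open>auto simp: discrete_valuation_def\<close>)
  then obtain x r where "v x = ereal r" "a < r" "r < b" by (auto simp: value_group_def)
  then show ?thesis by (intro exI[of _ x]) simp
qed

text \<open>Supplies elements of \<open>K\<close> whose values increase strictly and share the limit
  of \<open>c\<close>.\<close>

lemma interlacing_values:
  assumes "\<not> discrete_valuation v" and "strict_mono c"
  obtains x where "\<And>n::nat. ereal (c n) < v (x n)" "\<And>n. v (x n) < ereal (c (Suc n))"
proof -
  have "\<forall>n. \<exists>x. ereal (c n) < v x \<and> v x < ereal (c (Suc n))"
    using assms value_dense by (auto simp: strict_mono_Suc_iff)
  then show ?thesis using that by metis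
qed

section \<open>Pseudo-convergent sequences\<close>

text \<open>Each value lies strictly below the next one, which rules out infinity.\<close>

lemma pc_real:
  assumes "pseudo_convergent v s"
  obtains b where "\<And>n. v (s (Suc n) - s n) = ereal (b n)" "strict_mono b"
proof -
  have lt: "v (s (Suc n) - s n) < v (s (Suc (Suc n)) - s (Suc n))" for n
    using assms by (simp add: pseudo_convergent_def)
  have "\<exists>b. v (s (Suc n) - s n) = ereal b" for n
    using lt[of n] by (cases "v (s (Suc n) - s n)") auto
  then obtain b where b: "\<And>n. v (s (Suc n) - s n) = ereal (b n)" by metis
  with lt have "strict_mono b" by (auto simp: strict_mono_Suc_iff)
  with b show ?thesis using that by blast
qed

lemma pc_breadth_LIMSEQ:
  assumes "pseudo_convergent v s"
  shows "(\<lambda>n. v (s (Suc n) - s n)) \<longlonglongrightarrow> breadth v s"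
proof -
  have "incseq (\<lambda>n. v (s (Suc n) - s n))"
    using assms by (auto simp: incseq_Suc_iff pseudo_convergent_def intro: less_imp_le)
  then show ?thesis
    unfolding breadth_def using LIMSEQ_SUP limI by metis
qed

text \<open>In the telescoping sum for \<open>s m - s n\<close> the first difference has the
  strictly smallest value.\<close>

lemma pc_diff:
  assumes "pseudo_convergent v s" and "n < m"
  shows "v (s m - s n) = v (s (Suc n) - s n)"
proof -
  obtain b where b: "\<And>n. v (s (Suc n) - s n) = ereal (b n)" "strict_mono b"
    using pc_real[OF assms(1)] by blast
  from \<open>n < m\<close> have "Suc n \<le> m" by simp
  then show ?thesis
  proof (induction m rule: dec_induct)
    case (step m)
    have "v ((s m - s n) + (s (Suc m) - s m)) = v (s m - s n)"
      using step strict_monoD[OF b(2), of n m] by (intro v_add_eq) (simp add: b(1))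
    with step show ?case by simp
  qed simp
qed

section \<open>Independence of the distance from the representing sequences\<close>

lemma pc_ring_subset_imp_close:
  assumes s: "pseudo_convergent v s" and t: "pseudo_convergent v t"
    and sub: "pc_ring V s \<subseteq> pc_ring V t"
  shows "\<forall>\<^sub>F n in sequentially. v (s (Suc N) - s N) \<le> v (s n - t n)"
proof -
  obtain b where b: "\<And>n. v (s (Suc n) - s n) = ereal (b n)" "strict_mono b"
    using pc_real[OF s] by blast
  define c where "c = s (Suc N) - s N"
  have "c \<noteq> 0" using b(1)[of N] v_zero by (auto simp: c_def simp del: v_eq_PInf)
  \<comment> \<open>This is \<open>(X - s N) / c\<close>; its value at \<open>x\<close> lies in
    \<open>V\<close> exactly when \<open>x\<close> is in the closed ball about \<open>s N\<close>
    through \<open>s (Suc N)\<close>. The \<open>s n\<close> with \<open>n > N\<close> lie there,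
    and the inclusion of rings puts almost all \<open>t n\<close> there too.\<close>
  define \<phi> where "\<phi> = Fract [:- s N, 1:] [:c:]"
  have val\<phi>: "has_value_at \<phi> x y \<longleftrightarrow> y = (x - s N) / c" for x y
    unfolding \<phi>_def using \<open>c \<noteq> 0\<close> by (subst has_value_at_Fract) auto
  have inV: "(x - s N) / c \<in> V \<longleftrightarrow> v c \<le> v (x - s N)" for x
    unfolding V_iff v_divide[OF \<open>c \<noteq> 0\<close>]
    using b(1)[of N] by (cases "v (x - s N)") (auto simp: c_def)
  have v_diff_c: "v (s n - s N) = v c" if "N < n" for n
    using pc_diff[OF s that] by (simp add: c_def)
  then have "\<phi> \<in> pc_ring V s"
    by (auto simp: pc_ring_def val\<phi> inV intro: eventually_mono[OF eventually_gt_at_top[of N]])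
  with sub have "\<phi> \<in> pc_ring V t" by blast
  then have "\<forall>\<^sub>F n in sequentially. v c \<le> v (t n - s N)"
    by (simp add: pc_ring_def val\<phi> inV)
  with eventually_gt_at_top[of N] show ?thesis
  proof eventually_elim
    case (elim n)
    then show ?case
      using v_diff_c[of n] v_diff[of "s n - s N" "t n - s N"] by (simp add: c_def)
  qed
qed

lemma vdist_ultra: "vdist v x z \<le> max (vdist v x y) (vdist v y z)"
proof -
  have "min (v (x - y)) (v (y - z)) \<le> v (x - z)"
    using v_add[of "x - y" "y - z"] by simp
  then show ?thesis
    using exp_neg_antimono[of "v (x - y)" "v (x - z)"] exp_neg_antimono[of "v (y - z)" "v (x - z)"]
    by (auto simp: vdist_def min_def max_def split: if_splits)
qed

lemma vdist_commute: "vdist v x y = vdist v y x"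
  by (simp add: vdist_def v_minus_commute[of x])

abbreviation (input) trunc_dist :: "ereal \<Rightarrow> 'k \<Rightarrow> 'k \<Rightarrow> real" where
  "trunc_dist \<delta> x y \<equiv> max (vdist v x y - exp_neg \<delta>) 0"

lemma pc_ring_subset_imp_trunc_dist_tendsto_0:
  assumes s: "pseudo_convergent v s" "breadth v s = \<delta>" and t: "pseudo_convergent v t"
    and sub: "pc_ring V s \<subseteq> pc_ring V t" and "\<delta> \<noteq> -\<infinity>"
  shows "(\<lambda>n. trunc_dist \<delta> (s n) (t n)) \<longlonglongrightarrow> 0"
proof (rule LIMSEQ_I)
  fix e :: real assume "e > 0"
  obtain b where b: "\<And>n. v (s (Suc n) - s n) = ereal (b n)" "strict_mono b"
    using pc_real[OF s(1)] by blast
  have "(\<lambda>n. exp_neg (ereal (b n))) \<longlonglongrightarrow> exp_neg \<delta>"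
    using pc_breadth_LIMSEQ[OF s(1)] \<open>\<delta> \<noteq> -\<infinity>\<close> s(2) by (intro tendsto_exp_neg) (auto simp: b)
  then have "\<forall>\<^sub>F N in sequentially. exp_neg (ereal (b N)) < exp_neg \<delta> + e"
    using \<open>e > 0\<close> by (intro order_tendstoD) auto
  \<comment> \<open>The radii of the balls decrease to \<open>exp_neg \<delta>\<close>, so a late
    ball controls the truncated distance up to \<open>e\<close>.\<close>
  then obtain N where N: "exp_neg (ereal (b N)) < exp_neg \<delta> + e"
    by (auto simp: eventually_sequentially)
  have "\<forall>\<^sub>F n in sequentially. norm (trunc_dist \<delta> (s n) (t n) - 0) < e"
    using pc_ring_subset_imp_close[OF s(1) t sub, of N]
  proof eventually_elim
    case (elim n)
    then have "vdist v (s n) (t n) \<le> exp_neg (ereal (b N))"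
      unfolding vdist_def b by (intro exp_neg_antimono) auto
    with N \<open>e > 0\<close> show ?case by auto
  qed
  then show "\<exists>no. \<forall>n\<ge>no. norm (trunc_dist \<delta> (s n) (t n) - 0) < e"
    by (simp add: eventually_sequentially)
qed

text \<open>The ultrametric inequality is applied along \<open>s' n\<close>, \<open>s n\<close>,
  \<open>t n\<close>, \<open>t' n\<close>; the inclusions make the two outer distances vanish in the
  limit. Equality of limits follows by exchanging the roles.\<close>

lemma trunc_dist_limit_le:
  assumes s: "pseudo_convergent v s" "breadth v s = \<delta>" "pc_ring V s \<subseteq> pc_ring V s'"
    and t: "pseudo_convergent v t" "breadth v t = \<delta>" "pc_ring V t \<subseteq> pc_ring V t'"
    and s': "pseudo_convergent v s'" and t': "pseudo_convergent v t'"
    and r: "(\<lambda>n. trunc_dist \<delta> (s n) (t n)) \<longlonglongrightarrow> r"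
    and r': "(\<lambda>n. trunc_dist \<delta> (s' n) (t' n)) \<longlonglongrightarrow> r'" and "\<delta> \<noteq> -\<infinity>"
  shows "r' \<le> r"
proof -
  define M where "M n = max (trunc_dist \<delta> (s n) (s' n))
      (max (trunc_dist \<delta> (s n) (t n)) (trunc_dist \<delta> (t n) (t' n)))" for n
  have "trunc_dist \<delta> (s' n) (t' n) \<le> M n" for n
    using vdist_ultra[of "s' n" "t' n" "s n"] vdist_ultra[of "s n" "t' n" "t n"]
    by (auto simp: M_def vdist_commute[of "s' n" "s n"])
  moreover have "M \<longlonglongrightarrow> max 0 (max r 0)"
    unfolding M_def
    using pc_ring_subset_imp_trunc_dist_tendsto_0[OF s(1,2) s' s(3)]
      pc_ring_subset_imp_trunc_dist_tendsto_0[OF t(1,2) t' t(3)] r \<open>\<delta> \<noteq> -\<infinity>\<close>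
    by (intro tendsto_max) auto
  ultimately have "r' \<le> max 0 (max r 0)" using r' by (intro LIMSEQ_le) auto
  moreover have "0 \<le> r" using r by (rule LIMSEQ_le_const) auto
  ultimately show ?thesis by simp
qed

text \<open>Resolves the definite description: any pair of representatives with convergent distances
  computes it.\<close>

lemma breadth_dist_eqI:
  assumes s: "pseudo_convergent v s" "breadth v s = \<delta>"
    and t: "pseudo_convergent v t" "breadth v t = \<delta>"
    and r: "(\<lambda>n. trunc_dist \<delta> (s n) (t n)) \<longlonglongrightarrow> r" and "\<delta> \<noteq> -\<infinity>"
  shows "breadth_dist V v \<delta> (pc_ring V s) (pc_ring V t) = r"
  unfolding breadth_dist_def
proof (rule the_equality)
  fix r'
  assume "\<exists>s' t'. pseudo_convergent v s' \<and> breadth v s' = \<delta> \<and> pc_ring V s = pc_ring V s' \<and>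
    pseudo_convergent v t' \<and> breadth v t' = \<delta> \<and> pc_ring V t = pc_ring V t' \<and>
    (\<lambda>n. trunc_dist \<delta> (s' n) (t' n)) \<longlonglongrightarrow> r'"
  then obtain s' t' where s': "pseudo_convergent v s'" "breadth v s' = \<delta>" "pc_ring V s = pc_ring V s'"
    and t': "pseudo_convergent v t'" "breadth v t' = \<delta>" "pc_ring V t = pc_ring V t'"
    and r': "(\<lambda>n. trunc_dist \<delta> (s' n) (t' n)) \<longlonglongrightarrow> r'" by blast
  show "r' = r"
    using trunc_dist_limit_le[OF s _ t _ s'(1) t'(1) r r' \<open>\<delta> \<noteq> -\<infinity>\<close>]
      trunc_dist_limit_le[OF s'(1,2) _ t'(1,2) _ s(1) t(1) r' r \<open>\<delta> \<noteq> -\<infinity>\<close>] s'(3) t'(3)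
    by (intro antisym) auto
qed (use assms in blast)

section \<open>Values of polynomials on spheres about 0\<close>

text \<open>Induction along the Horner form \<open>a + x * poly f x\<close>. Monotonicity of
  \<open>m\<close> is carried along because it makes the values of \<open>x * poly f x\<close>
  strictly increasing, so that they meet \<open>v a\<close> at most once.\<close>

lemma poly_value_eventually:
  fixes \<gamma> :: "nat \<Rightarrow> real"
  assumes "strict_mono \<gamma>" and "f \<noteq> 0"
  shows "\<exists>m :: nat \<Rightarrow> real. \<exists>N. (\<forall>i\<ge>N. \<forall>j\<ge>i. m i \<le> m j) \<and>
           (\<forall>n\<ge>N. \<forall>x. v x = ereal (\<gamma> n) \<longrightarrow> v (poly f x) = ereal (m n))"
  using \<open>f \<noteq> 0\<close>
proof (induction f)
  case (pCons a f)
  show ?case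
  proof (cases "f = 0")
    case True
    with pCons have "a \<noteq> 0" by auto
    then obtain r where "v a = ereal r" by (rule v_real)
    with True show ?thesis by (intro exI[of _ "\<lambda>_. r"]) auto
  next
    case False
    from pCons.IH[OF this] obtain m :: "nat \<Rightarrow> real" and N
      where mono: "\<And>i j. N \<le> i \<Longrightarrow> i \<le> j \<Longrightarrow> m i \<le> m j"
        and m: "\<And>n x. N \<le> n \<Longrightarrow> v x = ereal (\<gamma> n) \<Longrightarrow> v (poly f x) = ereal (m n)" by blast
    define g where "g n = \<gamma> n + m n" for n
    have g_less: "g i < g j" if "N \<le> i" "i < j" for i j
      using mono[of i j] that strict_monoD[OF assms(1), of i j] by (simp add: g_def)
    then have g_le: "g i \<le> g j" if "N \<le> i" "i \<le> j" for i j
      using that by (cases "i = j") (auto intro: less_imp_le)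
    have g: "v (x * poly f x) = ereal (g n)" if "N \<le> n" "v x = ereal (\<gamma> n)" for n x
      using m[OF that] that by (simp add: v_mult g_def)
    show ?thesis
    proof (cases "a = 0")
      case True
      with g g_le show ?thesis by (intro exI[of _ g] exI[of _ N]) auto
    next
      case False
      then obtain r where r: "v a = ereal r" by (rule v_real)
      \<comment> \<open>Skips the only index at which \<open>a\<close> and
        \<open>x * poly f x\<close> may cancel; afterwards the value of the sum is the
        minimum.\<close>
      obtain N' where N': "N' \<ge> N" "\<And>n. n \<ge> N' \<Longrightarrow> g n \<noteq> r"
      proof (cases "\<exists>n\<ge>N. g n = r")
        case True
        then obtain n where "n \<ge> N" "g n = r" by blast
        with g_less[of n] show ?thesis by (intro that[of "Suc n"]) (auto simp: Suc_le_eq less_imp_neq[symmetric])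
      qed (use that[of N] in auto)
      have "v (a + x * poly f x) = ereal (min r (g n))" if "n \<ge> N'" "v x = ereal (\<gamma> n)" for n x
      proof -
        have "v (x * poly f x) = ereal (g n)" using g[of n x] N'(1) that by auto
        with N'(2)[OF that(1)] r v_add_eq[of a "x * poly f x"] v_add_eq[of "x * poly f x" a]
        show ?thesis by (cases "g n < r") (auto simp: add.commute min_def)
      qed
      moreover have "min r (g i) \<le> min r (g j)" if "N' \<le> i" "i \<le> j" for i j
        using g_le[of i j] that N'(1) by auto
      ultimately show ?thesis by (intro exI[of _ "\<lambda>n. min r (g n)"] exI[of _ N']) auto
    qed
  qed
qed simp

lemma poly_value_eventually_eq:
  fixes \<gamma> :: "nat \<Rightarrow> real"
  assumes "strict_mono \<gamma>"
  shows "\<forall>\<^sub>F n in sequentially. \<forall>x y. v x = ereal (\<gamma> n) \<longrightarrow> v y = ereal (\<gamma> n) \<longrightarrow>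
           v (poly f x) = v (poly f y)"
proof (cases "f = 0")
  case False
  then show ?thesis
    using poly_value_eventually[OF assms False] unfolding eventually_sequentially by metis
qed simp

lemma poly_nonzero_eventually:
  fixes \<gamma> :: "nat \<Rightarrow> real"
  assumes "strict_mono \<gamma>" and "f \<noteq> 0"
  shows "\<forall>\<^sub>F n in sequentially. \<forall>x. v x = ereal (\<gamma> n) \<longrightarrow> poly f x \<noteq> 0"
  using poly_value_eventually[OF assms] v_zero unfolding eventually_sequentially
  by (metis PInfty_neq_ereal(1))

text \<open>For large \<open>k\<close>, numerator and denominator of \<open>\<phi>\<close> have the
  same values at all \<open>E k n\<close> as at \<open>s k\<close>, and there the quotient lies in
  \<open>V\<close>. This is the convergence of the rings, tested on subbasic sets.\<close>

lemma pc_ring_eventually: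
  fixes \<gamma> :: "nat \<Rightarrow> real"
  assumes \<gamma>: "strict_mono \<gamma>" and s: "\<And>n. v (s n) = ereal (\<gamma> n)"
    and E: "\<And>k n. v (E k n) = ereal (\<gamma> k)" and \<phi>: "\<phi> \<in> pc_ring V s"
  shows "\<forall>\<^sub>F k in sequentially. \<phi> \<in> pc_ring V (E k)"
proof -
  obtain f g where fg: "\<phi> = Fract f g" "g \<noteq> 0" by (cases \<phi>) auto
  have "\<forall>\<^sub>F k in sequentially. \<exists>y\<in>V. has_value_at \<phi> (s k) y"
    using \<phi> by (simp add: pc_ring_def)
  with poly_value_eventually_eq[OF \<gamma>, of f] poly_value_eventually_eq[OF \<gamma>, of g]
    poly_nonzero_eventually[OF \<gamma> fg(2)]
  show ?thesis
  proof eventually_elim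
    case (elim k)
    have "poly g (s k) \<noteq> 0" using elim s by blast
    with elim(4) have "0 \<le> v (poly f (s k)) - v (poly g (s k))"
      by (auto simp: fg has_value_at_Fract V_iff v_divide)
    moreover have "poly g (E k n) \<noteq> 0" "v (poly f (E k n)) = v (poly f (s k))"
      "v (poly g (E k n)) = v (poly g (s k))" for n using elim s E by blast+
    ultimately show ?case
      by (auto simp: pc_ring_def fg has_value_at_Fract V_iff v_divide)
  qed
qed

section \<open>Construction of pseudo-convergent sequences\<close>

text \<open>The term of smaller value dominates each difference, so the breadth becomes the limit of
  the values themselves.\<close>

lemma pc_of_strict_mono_values:
  assumes "\<And>n. v (s n) < v (s (Suc n))"
  shows "v (s (Suc n) - s n) = v (s n)" and "pseudo_convergent v s"
proof -
  show "v (s (Suc n) - s n) = v (s n)" for n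
    using v_diff_eq[OF assms[of n]] by (simp add: v_minus_commute[of "s n"])
  then show "pseudo_convergent v s" using assms by (simp add: pseudo_convergent_def)
qed

lemma pc_of_breadth_exists:
  assumes "\<not> discrete_valuation v" and "ereal a < \<delta>"
  obtains t where "pseudo_convergent v t" "breadth v t = \<delta>" "\<And>n. ereal a < v (t n)"
proof -
  \<comment> \<open>Bounds starting at \<open>a\<close> and increasing to \<open>\<delta>\<close>;
    the values of \<open>t\<close> are then squeezed between \<open>c n\<close> and
    \<open>c (Suc n)\<close>.\<close>
  obtain c :: "nat \<Rightarrow> real" where c: "strict_mono c" "(\<lambda>n. ereal (c n)) \<longlonglongrightarrow> \<delta>" "a \<le> c 0"
  proof (cases \<delta>)
    case (real d)
    have "(\<lambda>n. d - (d - a) * inverse (real (Suc n))) \<longlonglongrightarrow> d - (d - a) * 0"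
      by (intro tendsto_intros LIMSEQ_inverse_real_of_nat)
    with real assms(2) show ?thesis
      by (intro that[of "\<lambda>n. d - (d - a) * inverse (real (Suc n))"]) (auto simp: strict_mono_Suc_iff)
  next
    case PInf
    have "filterlim (\<lambda>n. a + real n) at_top sequentially"
      by (intro filterlim_tendsto_add_at_top[OF tendsto_const] filterlim_real_sequentially)
    with PInf show ?thesis
      by (intro that[of "\<lambda>n. a + real n"]) (auto simp: strict_mono_Suc_iff tendsto_PInfty_eq_at_top)
  qed (use assms in auto)
  obtain t where t: "\<And>n. ereal (c n) < v (t n)" "\<And>n. v (t n) < ereal (c (Suc n))"
    using interlacing_values[OF assms(1) c(1)] by blast
  have inc: "v (t n) < v (t (Suc n))" for n using t(2)[of n] t(1)[of "Suc n"] by (rule less_trans)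
  have "(\<lambda>n. v (t n)) \<longlonglongrightarrow> \<delta>"
    using t by (intro tendsto_sandwich[OF _ _ c(2) LIMSEQ_Suc[OF c(2)]]) (auto intro: less_imp_le always_eventually)
  then have "breadth v t = \<delta>"
    unfolding breadth_def pc_of_strict_mono_values(1)[of t, OF inc] by (rule limI)
  moreover have "ereal a < v (t n)" for n
  proof -
    have "a \<le> c n" using c(3) strict_mono_less_eq[OF c(1), of 0 n] by simp
    then show ?thesis using t(1)[of n] by (metis ereal_less_eq(3) le_less_trans)
  qed
  ultimately show ?thesis using that pc_of_strict_mono_values(2)[of t, OF inc] by blast
qed

end

section \<open>Convergence of the rings and the contradiction\<close>

theorem proposition3p8:
  fixes V :: "'k::field set" and v :: "'k \<Rightarrow> ereal"
    and d' :: "'k poly fract set metric" and \<delta> :: ereal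
  assumes "valuation_domain V" and "rank_one V"
    and "is_valuation_of V v" and "\<not> discrete_valuation v"
    and "mspace d' = pc_rings V v"
    and "mtopology_of d' = subtopology (zariski_topology V) (pc_rings V v)"
    and "\<delta> \<noteq> -\<infinity>"
  shows "\<not> (\<forall>A\<in>pc_rings_breadth V v \<delta>. \<forall>B\<in>pc_rings_breadth V v \<delta>.
              mdist d' A B = breadth_dist V v \<delta> A B)"
proof
  assume eq: "\<forall>A\<in>pc_rings_breadth V v \<delta>. \<forall>B\<in>pc_rings_breadth V v \<delta>.
              mdist d' A B = breadth_dist V v \<delta> A B"
  interpret real_valuation V v by unfold_locales (fact assms(3))
  interpret M: Metric_space "mspace d'" "mdist d'" by (rule Metric_space_mspace_mdist)
  \<comment> \<open>For infinite \<open>\<delta>\<close>, \<open>real_of_ereal\<close> returns 0, so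
    \<open>a\<close> is some negative real.\<close>
  obtain a where a: "ereal a < \<delta>"
    using lt_ex[of "real_of_ereal \<delta>"] \<open>\<delta> \<noteq> -\<infinity>\<close> by (cases \<delta>) auto
  obtain t where t: "pseudo_convergent v t" "breadth v t = \<delta>" "\<And>n. ereal a < v (t n)"
    using pc_of_breadth_exists[OF assms(4) a] by blast
  obtain s where s: "\<And>n. ereal (a - inverse (real (Suc n))) < v (s n)"
    "\<And>n. v (s n) < ereal (a - inverse (real (Suc (Suc n))))"
    using interlacing_values[OF assms(4), of "\<lambda>n. a - inverse (real (Suc n))"]
    by (auto simp: strict_mono_Suc_iff)
  have inc: "v (s n) < v (s (Suc n))" for n using s(2)[of n] s(1)[of "Suc n"] by (rule less_trans)
  have s_less: "v (s n) < ereal a" for n by (rule less_trans[OF s(2)]) simp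
  have "\<exists>r. v (s n) = ereal r" for n using inc[of n] by (cases "v (s n)") auto
  then obtain \<gamma> where \<gamma>: "\<And>n. v (s n) = ereal (\<gamma> n)" by metis
  have "strict_mono \<gamma>" using inc by (simp add: strict_mono_Suc_iff \<gamma>)
  note pcs = pc_of_strict_mono_values[of s, OF inc]
  define E where "E k n = s k + t n" for k n
  \<comment> \<open>Translation by \<open>s k\<close> preserves differences, hence
    pseudo-convergence and breadth.\<close>
  have E_diff: "E k (Suc n) - E k n = t (Suc n) - t n" for k n by (simp add: E_def)
  have E_pc: "pseudo_convergent v (E k)" "breadth v (E k) = \<delta>" for k
    using t(1,2) by (simp_all add: pseudo_convergent_def breadth_def E_diff)
  have vE: "v (E k n) = ereal (\<gamma> k)" for k n
    using v_add_eq[OF less_trans[OF s_less t(3)]] by (simp add: E_def \<gamma>)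
  \<comment> \<open>\<open>L\<close> is placed only in the whole space \<open>pc_rings V v\<close>,
    where \<open>d'\<close> is defined; the assumed equality of distances is applied to the rings
    \<open>R k\<close>.\<close>
  define L where "L = pc_ring V s"
  define R where "R k = pc_ring V (E k)" for k
  have L: "L \<in> pc_rings V v" and R: "R k \<in> pc_rings V v" "R k \<in> pc_rings_breadth V v \<delta>" for k
    using pcs(2) E_pc by (auto simp: L_def R_def pc_rings_def pc_rings_breadth_def)
  \<comment> \<open>That the rings are valuation domains over \<open>V\<close> is read off from the
    hypotheses on \<open>d'\<close>: its points form the topspace of a subspace of the Zariski
    space.\<close>
  have "topspace (zariski_topology V) \<subseteq> Zar V"
    by (auto simp: zariski_topology_def topology_generated_by_topspace)
  moreover have "topspace (mtopology_of d') = mspace d'" by simp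
  ultimately have Zar: "pc_rings V v \<subseteq> Zar V"
    using assms(5,6) by (simp add: topspace_subtopology) blast
  \<comment> \<open>With \<open>1 \<in> L\<close>, the ring \<open>L\<close> lies in the subbasic
    set of \<open>\<phi> = 1\<close>, hence in the union of the subbasis.\<close>
  have "L \<in> Zar V" "1 \<in> L" using L Zar by (auto simp: Zar_def valuation_domain_def)
  have "limitin (zariski_topology V) R L sequentially"
    unfolding zariski_topology_def
  proof (rule limitin_topology_generated_by)
    fix U assume "U \<in> range (\<lambda>\<phi>. {W \<in> Zar V. \<phi> \<in> W})" and "L \<in> U"
    then obtain \<phi> where U: "U = {W \<in> Zar V. \<phi> \<in> W}" and "\<phi> \<in> L" by blast
    then have "\<forall>\<^sub>F k in sequentially. \<phi> \<in> R k"
      unfolding L_def R_def by (intro pc_ring_eventually[OF \<open>strict_mono \<gamma>\<close> \<gamma> vE])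
    then show "\<forall>\<^sub>F k in sequentially. R k \<in> U"
      by (rule eventually_mono) (use R(1) Zar in \<open>auto simp: U\<close>)
  qed (use \<open>L \<in> Zar V\<close> \<open>1 \<in> L\<close> in auto)
  then have "limitin M.mtopology R L sequentially"
    using assms(6) L R(1) by (simp add: limitin_subtopology mtopology_of_def)
  moreover define e where "e = exp_neg (ereal a) - exp_neg \<delta>"
  moreover have "e > 0" using exp_neg_strict_antimono[OF _ a] by (simp add: e_def)
  ultimately obtain N where N: "\<And>k. k \<ge> N \<Longrightarrow> mdist d' (R k) L < e / 2"
    unfolding M.limitin_metric eventually_sequentially by (metis half_gt_zero)
  have "mdist d' (R N) (R (Suc N)) \<le> mdist d' (R N) L + mdist d' (R (Suc N)) L"
    using M.triangle[of "R N" L "R (Suc N)"] L R(1) assms(5) by (simp add: M.commute)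
  also have "\<dots> < e" using N[of N] N[of "Suc N"] by simp
  finally have "mdist d' (R N) (R (Suc N)) < e" .
  moreover have "mdist d' (R N) (R (Suc N)) = max (exp_neg (ereal (\<gamma> N)) - exp_neg \<delta>) 0"
  proof -
    \<comment> \<open>The \<open>t n\<close> cancel, leaving \<open>s N - s (Suc N)\<close>, so the
      distances are constant in \<open>n\<close>.\<close>
    have "vdist v (E N n) (E (Suc N) n) = exp_neg (ereal (\<gamma> N))" for n
      using v_diff_eq[OF inc[of N]] by (simp add: vdist_def E_def \<gamma>)
    then have "breadth_dist V v \<delta> (R N) (R (Suc N)) = max (exp_neg (ereal (\<gamma> N)) - exp_neg \<delta>) 0"
      unfolding R_def using E_pc \<open>\<delta> \<noteq> -\<infinity>\<close> by (intro breadth_dist_eqI) auto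
    then show ?thesis using eq R(2) by simp
  qed
  \<comment> \<open>This bounds the distance of \<open>R N\<close> and \<open>R (Suc N)\<close>
    below by \<open>e\<close>, against the triangle inequality through \<open>L\<close>.\<close>
  moreover have "exp_neg (ereal a) \<le> exp_neg (ereal (\<gamma> N))"
    using s_less[of N] by (intro exp_neg_antimono) (auto simp: \<gamma>)
  ultimately show False by (simp add: e_def)
qed

end
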